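(* Let $d\ge 1$ and $\mu\ge 1$. The competitive ratio of Next Fit for the MinUsageTime Dynamic Vector Bin Packing problem in $d$ dimensions is at least $2\mu d$; i.e., for every $\delta>0$ there is an instance $\mathcal{R}$ whose ratio of maximum to minimum item duration is $\mu$ such that $\mathsf{cost}(\mathrm{NF},\mathcal{R}) \ge (2\mu d-\delta)\,\mathsf{OPT}(\mathcal{R})$.
   Context: MinUsageTime Dynamic Vector Bin Packing (non-clairvoyant, online, no repacking): an instance is a finite list $\mathcal{R}$ of items; each item $r$ has arrival time $a(r)\ge 0$, departure time $e(r)>a(r)$, and size $\mathbf{s}(r)\in[0,1]^d$. Its active interval is $I(r)=[a(r),e(r))$ with duration $e(r)-a(r)$. Bins have capacity $1$ in each of the $d$ coordinates. Items are revealed in order of arrival (ties in a given order); on arrival, an item must be irrevocably placed into a bin such that the total size of items currently active in that bin stays $\le 1$ in every coordinate; the departure time is unknown at arrival. A bin is open while it contains an active item; once all its items have departed it is closed and never used again. If bin $B_i$ receives item set $R_i$, the cost of algorithm $\mathcal{A}$ is $\mathsf{cost}(\mathcal{A},\mathcal{R})=\sum_i \mathrm{span}(R_i)$, where $\mathrm{span}(S)$ is the Lebesgue measure of $\bigcup_{r\in S} I(r)$. $\mathsf{OPT}(\mathcal{R})=\int \mathsf{OPT}(\mathcal{R},t)\,dt$, where $\mathsf{OPT}(\mathcal{R},t)$ is the minimum number of unit-capacity bins into which the items active at time $t$ can be packed (offline, repacking allowed). Next Fit: at any time there is at most one designated current bin; an arriving item is placed in the current bin if it fits; otherwise the current bin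 is released (it receives no further items) and a new bin is opened for the item and becomes the current bin. *)

theory Defs
  imports "HOL-Analysis.Analysis"
begin

record ('d::finite) item =
  arrival :: real
  departure :: real
  item_size :: "real ^ 'd"

definition valid_item :: "('d::finite) item \<Rightarrow> bool" where
  "valid_item r \<longleftrightarrow> 0 \<le> arrival r \<and> arrival r < departure r \<and>
     (\<forall>i. 0 \<le> item_size r $ i \<and> item_size r $ i \<le> 1)"

text \<open>An instance is an arbitrary list, so that several items may have identical data. It need not
  be sorted; its order only serves to break ties between equal arrival times.\<close>

definition valid_instance :: "('d::finite) item list \<Rightarrow> bool" where
  "valid_instance R \<longleftrightarrow> (\<forall>r\<in>set R. valid_item r)"

definition active_interval :: "('d::finite) item \<Rightarrow> real set" where
  "active_interval r = {arrival r..<departure r}"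

definition duration :: "('d::finite) item \<Rightarrow> real" where
  "duration r = departure r - arrival r"

text \<open>Only meaningful for nonempty instances.\<close>

definition duration_ratio :: "('d::finite) item list \<Rightarrow> real" where
  "duration_ratio R = Max (duration ` set R) / Min (duration ` set R)"

definition item_span :: "('d::finite) item set \<Rightarrow> real" where
  "item_span S = measure lborel (\<Union>r\<in>S. active_interval r)"

text \<open>A bin is represented by the list of all items it has ever received, a packing by the list of
  its bins, and an algorithm by the map from instances to the resulting packings.\<close>

definition cost :: "(('d::finite) item list \<Rightarrow> 'd item list list) \<Rightarrow> 'd item list \<Rightarrow> real" where
  "cost alg R = (\<Sum>B\<leftarrow>alg R. item_span (set B))"

definition bin_open :: "('d::finite) item list \<Rightarrow> real \<Rightarrow> bool" where
  "bin_open B t \<longleftrightarrow> (\<exists>r\<in>set B. t \<in> active_interval r)"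

definition fits :: "('d::finite) item list \<Rightarrow> 'd item \<Rightarrow> bool" where
  "fits B r \<longleftrightarrow>
     (\<forall>i. (\<Sum>x\<leftarrow>filter (\<lambda>x. arrival r \<in> active_interval x) B. item_size x $ i)
            + item_size r $ i \<le> 1)"

text \<open>Bins are listed most recently opened first. The head is the current bin as long as it is open;
  if all its items have departed, it is closed and there is no current bin.\<close>

fun next_fit_step :: "('d::finite) item list list \<Rightarrow> 'd item \<Rightarrow> 'd item list list" where
  "next_fit_step [] r = [[r]]"
| "next_fit_step (B # Bs) r =
     (if bin_open B (arrival r) \<and> fits B r then (r # B) # Bs else [r] # B # Bs)"

text \<open>\<open>sort_key\<close> is stable, hence items with equal arrival time keep their order in the instance.\<close>

definition next_fit :: "('d::finite) item list \<Rightarrow> 'd item list list" where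
  "next_fit R = foldl next_fit_step [] (sort_key arrival R)"

definition active_indices :: "('d::finite) item list \<Rightarrow> real \<Rightarrow> nat set" where
  "active_indices R t = {k. k < length R \<and> t \<in> active_interval (R ! k)}"

definition packable :: "('d::finite) item list \<Rightarrow> real \<Rightarrow> nat \<Rightarrow> bool" where
  "packable R t m \<longleftrightarrow>
     (\<exists>f :: nat \<Rightarrow> nat. (\<forall>k\<in>active_indices R t. f k < m) \<and>
        (\<forall>j<m. \<forall>i. (\<Sum>k\<in>{k\<in>active_indices R t. f k = j}. item_size (R ! k) $ i) \<le> 1))"

definition OPT_at :: "('d::finite) item list \<Rightarrow> real \<Rightarrow> nat" where
  "OPT_at R t = (LEAST m. packable R t m)"

definition OPT :: "('d::finite) item list \<Rightarrow> real" where
  "OPT R = (\<integral>t. real (OPT_at R t) \<partial>lborel)"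

text \<open>The competitive ratio as a function of the duration ratio \<open>\<mu>\<close>. The denominator is positive
  for every nonempty valid instance.\<close>

definition competitive_ratio ::
    "(('d::finite) item list \<Rightarrow> 'd item list list) \<Rightarrow> real \<Rightarrow> ereal" where
  "competitive_ratio alg \<mu> =
     (SUP R\<in>{R. valid_instance R \<and> R \<noteq> [] \<and> duration_ratio R = \<mu>}. ereal (cost alg R / OPT R))"

end

theory Submission
  imports Defs
begin

text \<open>All items arrive at time 0. For each coordinate \<open>i\<close>, many pairs arrive: a short item of
  size \<open>1/2\<close> in coordinate \<open>i\<close> only, followed by a tiny item of duration \<open>\<mu>\<close>. Within
  the phase of coordinate \<open>i\<close>, two short items and a tiny one do not fit together, so every pair
  occupies its own Next Fit bin, which the tiny item keeps open until time \<open>\<mu>\<close>. A short item of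
  size 1 in every coordinate separates consecutive phases. An offline packing can put all
  tiny items into one bin, \<open>2 d\<close> halves, two for each coordinate, into each of \<open>m\<close> bins, and
  every separator into a bin of its own. With \<open>2 m\<close> pairs in each phase, Next Fit pays more than
  \<open>2 m d \<mu>\<close> and the optimum pays at most \<open>m + d + \<mu>\<close>.\<close>

section \<open>Items and the instance\<close>

definition zero_item :: "real \<Rightarrow> real ^ 'd \<Rightarrow> 'd::finite item" where
  "zero_item e s = \<lparr>arrival = 0, departure = e, item_size = s\<rparr>"

lemma zero_item_simps [simp]:
  "arrival (zero_item e s) = 0" "departure (zero_item e s) = e" "item_size (zero_item e s) = s"
  "duration (zero_item e s) = e" "active_interval (zero_item e s) = {0..<e}"
  by (simp_all add: zero_item_def duration_def active_interval_def)

definition full_item :: "'d::finite item" where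
  "full_item = zero_item 1 (\<chi> i. 1)"

definition half_item :: "'d \<Rightarrow> 'd::finite item" where
  "half_item k = zero_item 1 (\<chi> i. if i = k then 1/2 else 0)"

definition tiny_item :: "real \<Rightarrow> real \<Rightarrow> 'd::finite item" where
  "tiny_item \<mu> \<epsilon> = zero_item \<mu> (\<chi> i. \<epsilon>)"

lemmas bad_item_defs = full_item_def half_item_def tiny_item_def

text \<open>The second components are the bins of the offline packing: bin 0 receives the tiny items,
  bins \<open>1, \<dots>, m\<close> the halves, and the remaining \<open>d\<close> bins the full items.\<close>

definition labelled_phase ::
    "real \<Rightarrow> real \<Rightarrow> nat \<Rightarrow> (nat \<Rightarrow> 'd) \<Rightarrow> nat \<Rightarrow> ('d::finite item \<times> nat) list" where
  "labelled_phase \<mu> \<epsilon> m \<beta> p =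
     (full_item, m + 1 + p) #
     concat (map (\<lambda>j. [(half_item (\<beta> p), j + 1), (tiny_item \<mu> \<epsilon>, 0),
                       (half_item (\<beta> p), j + 1), (tiny_item \<mu> \<epsilon>, 0)]) [0..<m])"

text \<open>Coordinates are elements of the unordered finite type \<open>'d\<close>, so phases are
  numbered and \<open>\<beta>\<close> translates a phase number into its coordinate; it is later
  chosen as a bijection.\<close>

definition labelled_instance ::
    "real \<Rightarrow> real \<Rightarrow> nat \<Rightarrow> (nat \<Rightarrow> 'd) \<Rightarrow> ('d::finite item \<times> nat) list" where
  "labelled_instance \<mu> \<epsilon> m \<beta> = concat (map (labelled_phase \<mu> \<epsilon> m \<beta>) [0..<CARD('d)])"

definition bad_instance ::
    "real \<Rightarrow> real \<Rightarrow> nat \<Rightarrow> (nat \<Rightarrow> 'd) \<Rightarrow> 'd::finite item list" where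
  "bad_instance \<mu> \<epsilon> m \<beta> = map fst (labelled_instance \<mu> \<epsilon> m \<beta>)"

lemma map_fst_labelled_phase:
  "map fst (labelled_phase \<mu> \<epsilon> m \<beta> p) =
     full_item # concat (map (\<lambda>_. [half_item (\<beta> p), tiny_item \<mu> \<epsilon>,
                                    half_item (\<beta> p), tiny_item \<mu> \<epsilon>]) [0..<m])"
  by (simp add: labelled_phase_def map_concat comp_def)

lemma bad_instance_eq:
  "bad_instance \<mu> \<epsilon> m (\<beta> :: nat \<Rightarrow> 'd::finite) =
     concat (map (\<lambda>p. map fst (labelled_phase \<mu> \<epsilon> m \<beta> p)) [0..<CARD('d)])"
  by (simp add: bad_instance_def labelled_instance_def map_concat comp_def)

lemma sum_list_concat: "sum_list (concat xss) = (\<Sum>xs\<leftarrow>xss. sum_list xs)"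
  by (induction xss) simp_all

lemma set_bad_instance:
  assumes "m > 0"
  shows "set (bad_instance \<mu> \<epsilon> m (\<beta> :: nat \<Rightarrow> 'd::finite)) =
     {full_item, tiny_item \<mu> \<epsilon>} \<union> (half_item \<circ> \<beta>) ` {..<CARD('d)}"
proof -
  have "\<exists>p. p < CARD('d)"
    using zero_less_card_finite by blast
  with assms show ?thesis
    unfolding bad_instance_eq map_fst_labelled_phase by (auto simp: lessThan_def)
qed

lemma bad_instance_nonempty: "m > 0 \<Longrightarrow> bad_instance \<mu> \<epsilon> m \<beta> \<noteq> []"
  using set_bad_instance[of m \<mu> \<epsilon> \<beta>] by auto

subsection \<open>Next Fit on the bad instance\<close>

text \<open>These are the two possible current bins when a separator arrives: the previous separator
  alone, if \<open>m = 0\<close>, or a finished pair.\<close>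

lemma not_fits_full:
  assumes "\<epsilon> > 0" "\<mu> > 0"
  shows "\<not> fits [full_item] full_item"
    and "\<not> fits [tiny_item \<mu> \<epsilon>, half_item k] full_item"
  using assms by (auto simp: fits_def bad_item_defs)

text \<open>For the pair, coordinate \<open>k\<close> would carry
  \<open>1/2 + \<epsilon> + 1/2\<close>, so an arbitrarily small positive \<open>\<epsilon>\<close>
  already forces a new bin.\<close>

lemma not_fits_half:
  assumes "\<epsilon> > 0" "\<mu> > 0"
  shows "\<not> fits [full_item] (half_item k)"
    and "\<not> fits [tiny_item \<mu> \<epsilon>, half_item k] (half_item k)"
  using assms by (auto simp: fits_def bad_item_defs)

text \<open>The invariant is that the current bin rejects \<open>half_item k\<close>. A half then
  opens a bin, its tiny item joins it because \<open>\<epsilon> \<le> 1/2\<close>, and the completed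
  pair again rejects halves. Each entry of \<open>js\<close> yields two such bins.\<close>

lemma next_fit_pairs:
  fixes k :: "'d::finite"
  assumes "0 < \<epsilon>" "\<epsilon> \<le> 1/2" "\<mu> > 0" "\<not> fits B (half_item k)"
  shows "foldl next_fit_step (B # S)
           (concat (map (\<lambda>_. [half_item k, tiny_item \<mu> \<epsilon>, half_item k, tiny_item \<mu> \<epsilon>]) js)) =
         replicate (2 * length js) [tiny_item \<mu> \<epsilon>, half_item k] @ B # S"
  using assms(4)
proof (induction js arbitrary: B S)
  case (Cons j js)
  have half_step: "next_fit_step (C # T) (half_item k) = [half_item k] # C # T"
    if "\<not> fits C (half_item k)" for C T
    using that by simp
  have tiny_step: "next_fit_step ([half_item k] # T) (tiny_item \<mu> \<epsilon>) =
      [tiny_item \<mu> \<epsilon>, half_item k] # T" for T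
    using assms by (auto simp: bin_open_def fits_def bad_item_defs)
  show ?case
    using Cons.prems not_fits_half(2)[OF assms(1,3), of k]
      Cons.IH[OF not_fits_half(2)[OF assms(1,3), of k]]
    by (simp add: half_step tiny_step replicate_app_Cons_same del: next_fit_step.simps)
qed simp

text \<open>Every phase starts by opening a bin for its separator and ends in a state that rejects
  the next separator. Since newer bins come first, the phases appear in reverse order.\<close>

lemma next_fit_phases:
  fixes \<beta> :: "nat \<Rightarrow> 'd::finite"
  assumes "0 < \<epsilon>" "\<epsilon> \<le> 1/2" "\<mu> > 0" "S = [] \<or> \<not> fits (hd S) full_item"
  shows "foldl next_fit_step S (concat (map (\<lambda>p. map fst (labelled_phase \<mu> \<epsilon> m \<beta> p)) ps)) =
         concat (map (\<lambda>p. replicate (2 * m) [tiny_item \<mu> \<epsilon>, half_item (\<beta> p)] @ [[full_item]])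
           (rev ps)) @ S"
  using assms(4)
proof (induction ps arbitrary: S)
  case (Cons p ps)
  let ?S = "replicate (2 * m) [tiny_item \<mu> \<epsilon>, half_item (\<beta> p)] @ [full_item] # S"
  have "next_fit_step S full_item = [full_item] # S"
    using Cons.prems by (cases S) auto
  then have "foldl next_fit_step S (map fst (labelled_phase \<mu> \<epsilon> m \<beta> p)) = ?S"
    using next_fit_pairs[OF assms(1-3) not_fits_half(1)[OF assms(1,3)], where js = "[0..<m]"]
    by (simp add: map_fst_labelled_phase)
  \<comment> \<open>The head is the separator itself if \<open>m = 0\<close>, and a pair
    otherwise.\<close>
  moreover have "\<not> fits (hd ?S) full_item"
    using not_fits_full[OF assms(1,3)] by (cases m) simp_all
  ultimately show ?case
    using Cons.IH[of ?S] by simp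
qed simp

lemma next_fit_bad_instance:
  fixes \<beta> :: "nat \<Rightarrow> 'd::finite"
  assumes "0 < \<epsilon>" "\<epsilon> \<le> 1/2" "\<mu> > 0"
  shows "next_fit (bad_instance \<mu> \<epsilon> m \<beta>) =
         concat (map (\<lambda>p. replicate (2 * m) [tiny_item \<mu> \<epsilon>, half_item (\<beta> p)] @ [[full_item]])
           (rev [0..<CARD('d)]))"
proof -
  have "arrival r = 0" if "r \<in> set (bad_instance \<mu> \<epsilon> m \<beta>)" for r
    using that unfolding bad_instance_eq map_fst_labelled_phase
    by (auto simp: bad_item_defs split: if_splits)
  then have "map arrival (bad_instance \<mu> \<epsilon> m \<beta>) = map (\<lambda>_. 0) (bad_instance \<mu> \<epsilon> m \<beta>)"
    by simp
  then have "sorted (map arrival (bad_instance \<mu> \<epsilon> m \<beta>))"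
    by (simp add: map_replicate_const)
  then have "sort_key arrival (bad_instance \<mu> \<epsilon> m \<beta>) = bad_instance \<mu> \<epsilon> m \<beta>"
    by (rule sort_key_id_if_sorted)
  then show ?thesis
    using next_fit_phases[OF assms, of "[]"] by (simp add: next_fit_def bad_instance_eq)
qed

lemma cost_bad_instance:
  fixes \<beta> :: "nat \<Rightarrow> 'd::finite"
  assumes "0 < \<epsilon>" "\<epsilon> \<le> 1/2" "\<mu> \<ge> 1"
  shows "cost next_fit (bad_instance \<mu> \<epsilon> m \<beta>) = real CARD('d) * (2 * real m * \<mu> + 1)"
proof -
  have "{0..<\<mu>} \<union> {0..<1} = {0..<\<mu>}"
    using assms by auto
  then have pair: "item_span (set [tiny_item \<mu> \<epsilon>, half_item k]) = \<mu>" for k :: 'd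
    using assms by (simp add: item_span_def bad_item_defs)
  have "item_span (set [full_item :: 'd item]) = 1"
    by (simp add: item_span_def bad_item_defs)
  with pair show ?thesis
    using assms
    by (simp add: cost_def next_fit_bad_instance map_concat comp_def sum_list_concat
        sum_list_replicate sum_list_triv del: set_simps)
qed

subsection \<open>The offline packing\<close>

text \<open>The labels serve as the packing. Only active items need a label below \<open>m\<close>,
  so fewer bins suffice once the short items have left.\<close>

lemma packable_map_fst:
  fixes L :: "('d::finite item \<times> nat) list"
  assumes "\<And>x. x \<in> set L \<Longrightarrow> t \<in> active_interval (fst x) \<Longrightarrow> snd x < m"
    and "\<And>j i. j < m \<Longrightarrow>
      (\<Sum>x\<leftarrow>L. if t \<in> active_interval (fst x) \<and> snd x = j then item_size (fst x) $ i else 0) \<le> 1"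
  shows "packable (map fst L) t m"
  unfolding packable_def
proof (intro exI[of _ "\<lambda>k. snd (L ! k)"] conjI ballI allI impI)
  fix k assume "k \<in> active_indices (map fst L) t"
  then show "snd (L ! k) < m"
    using assms(1)[of "L ! k"] by (auto simp: active_indices_def)
next
  fix j i assume "j < m"
  have "(\<Sum>k\<in>{k \<in> active_indices (map fst L) t. snd (L ! k) = j}. item_size (map fst L ! k) $ i) =
    (\<Sum>k = 0..<length L. if t \<in> active_interval (fst (L ! k)) \<and> snd (L ! k) = j
       then item_size (fst (L ! k)) $ i else 0)"
    by (rule sum.mono_neutral_cong_left) (auto simp: active_indices_def)
  also have "\<dots> = (\<Sum>x\<leftarrow>L. if t \<in> active_interval (fst x) \<and> snd x = j
       then item_size (fst x) $ i else 0)"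
    by (simp add: sum_list_sum_nth)
  also have "\<dots> \<le> 1"
    using \<open>j < m\<close> by (rule assms(2))
  finally show "(\<Sum>k\<in>{k \<in> active_indices (map fst L) t. snd (L ! k) = j}.
      item_size (map fst L ! k) $ i) \<le> 1" .
qed

lemma load_labelled_instance:
  fixes \<beta> :: "nat \<Rightarrow> 'd::finite"
  assumes "\<epsilon> > 0" "2 * real m * real CARD('d) * \<epsilon> \<le> 1" "inj_on \<beta> {..<CARD('d)}"
  shows "(\<Sum>x\<leftarrow>labelled_instance \<mu> \<epsilon> m \<beta>.
           if t \<in> active_interval (fst x) \<and> snd x = j then item_size (fst x) $ i else 0) \<le> 1"
    (is "?load \<le> 1")
proof -
  let ?full = "\<lambda>p. if t \<in> {0..<1::real} \<and> m + 1 + p = j then 1 else 0 :: real"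
  let ?tiny = "if t \<in> {0..<\<mu>} \<and> j = 0 then \<epsilon> else 0"
  \<comment> \<open>The value is 1 because step \<open>l\<close> of a phase puts two halves into the
    same bin; likewise it contributes two tiny items.\<close>
  let ?half = "\<lambda>p l. if t \<in> {0..<1::real} \<and> l + 1 = j \<and> i = \<beta> p then 1 else 0 :: real"
  have eq: "?load = (\<Sum>p<CARD('d). ?full p + (\<Sum>l<m. ?half p l + 2 * ?tiny))"
    unfolding labelled_instance_def labelled_phase_def
    by (auto simp: map_concat comp_def sum_list_concat bad_item_defs interv_sum_list_conv_sum_set_nat
        atLeast0LessThan intro!: sum.cong)
  consider "j = 0" | "0 < j" "j \<le> m" | "m < j"
    by linarith
  then show ?thesis
  proof cases
    case 1
    then have "?load = 2 * real m * real CARD('d) * ?tiny"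
      unfolding eq by simp
    also have "\<dots> \<le> 1"
      using assms by auto
    finally show ?thesis .
  next
    case 2
    have half: "(\<Sum>l<m. ?half p l) \<le> (if i = \<beta> p then 1 else 0)" for p
    proof -
      have "(\<Sum>l<m. ?half p l) \<le> (\<Sum>l<m. if l = j - 1 then if i = \<beta> p then 1 else 0 else 0)"
        by (intro sum_mono) auto
      then show ?thesis using 2 by (simp split: if_splits)
    qed
    have "?load = (\<Sum>p<CARD('d). \<Sum>l<m. ?half p l)"
      unfolding eq using 2 by (intro sum.cong) auto
    also have "\<dots> \<le> (\<Sum>p<CARD('d). if i = \<beta> p then 1 else 0)"
      by (intro sum_mono half)
    also have "\<dots> = real (card {p \<in> {..<CARD('d)}. i = \<beta> p})"
      by (simp add: sum.If_cases Int_def)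
    \<comment> \<open>By injectivity of \<open>\<beta>\<close>, only one phase loads coordinate
      \<open>i\<close> of this bin.\<close>
    also have "card {p \<in> {..<CARD('d)}. i = \<beta> p} \<le> 1"
      using assms(3) by (auto simp: card_le_Suc0_iff_eq inj_on_def)
    finally show ?thesis by simp
  next
    case 3
    have "?load = (\<Sum>p<CARD('d). ?full p)"
      unfolding eq using 3 by (intro sum.cong) auto
    also have "\<dots> \<le> (\<Sum>p<CARD('d). if p = j - m - 1 then 1 else 0)"
      by (intro sum_mono) auto
    also have "\<dots> \<le> 1"
      by simp
    finally show ?thesis .
  qed
qed

lemma packable_bad_instance:
  fixes \<beta> :: "nat \<Rightarrow> 'd::finite"
  assumes "\<epsilon> > 0" "2 * real m * real CARD('d) * \<epsilon> \<le> 1" "inj_on \<beta> {..<CARD('d)}"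
  shows "packable (bad_instance \<mu> \<epsilon> m \<beta>) t (m + CARD('d) + 1)"
    and "t \<ge> 1 \<Longrightarrow> packable (bad_instance \<mu> \<epsilon> m \<beta>) t 1"
proof -
  let ?L = "labelled_instance \<mu> \<epsilon> m \<beta>"
  \<comment> \<open>The largest label is that of the last separator,
    \<open>m + 1 + (CARD('d) - 1)\<close>.\<close>
  have "snd x < m + CARD('d) + 1" if "x \<in> set ?L" for x
    using that by (auto simp: labelled_instance_def labelled_phase_def)
  then show "packable (bad_instance \<mu> \<epsilon> m \<beta>) t (m + CARD('d) + 1)"
    unfolding bad_instance_def by (intro packable_map_fst load_labelled_instance[OF assms])
  have "snd x < 1" if "t \<ge> 1" "x \<in> set ?L" "t \<in> active_interval (fst x)" for x
    using that by (auto simp: labelled_instance_def labelled_phase_def bad_item_defs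
        split: if_splits)
  then show "packable (bad_instance \<mu> \<epsilon> m \<beta>) t 1" if "t \<ge> 1"
    unfolding bad_instance_def
    using that by (intro packable_map_fst load_labelled_instance[OF assms])
qed

section \<open>The optimum at a fixed time and its integral\<close>

lemma OPT_at_cong:
  "active_indices R t = active_indices R t' \<Longrightarrow> OPT_at R t = OPT_at R t'"
  by (simp add: OPT_at_def packable_def)

lemma OPT_at_eq_0:
  assumes "active_indices R t = {}"
  shows "OPT_at R t = 0"
proof -
  have "packable R t 0"
    using assms by (simp add: packable_def)
  then show ?thesis
    by (simp add: OPT_at_def)
qed

text \<open>Some packing must be known to exist, so that \<open>LEAST\<close> is attained; the bin
  of an active item then has an index below \<open>OPT_at R t\<close>.\<close>

lemma OPT_at_pos:
  assumes "k \<in> active_indices R t" "packable R t m"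
  shows "OPT_at R t > 0"
proof -
  have "packable R t (OPT_at R t)"
    unfolding OPT_at_def using assms(2) by (rule LeastI)
  with assms(1) show ?thesis
    by (auto simp: packable_def)
qed

text \<open>The optimum is constant on \<open>[0, 1)\<close>, with at most \<open>m + d + 1\<close>
  bins, and on \<open>[1, \<mu>)\<close>, where only tiny items remain and one bin suffices. Here
  \<open>d\<close> is \<open>CARD('d)\<close>.\<close>

lemma OPT_bad_instance:
  fixes \<beta> :: "nat \<Rightarrow> 'd::finite"
  assumes "\<epsilon> > 0" "2 * real m * real CARD('d) * \<epsilon> \<le> 1" "inj_on \<beta> {..<CARD('d)}"
    and "\<mu> \<ge> 1" "m > 0"
  shows "0 < OPT (bad_instance \<mu> \<epsilon> m \<beta>)"
    and "OPT (bad_instance \<mu> \<epsilon> m \<beta>) \<le> real m + real CARD('d) + \<mu>"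
proof -
  let ?R = "bad_instance \<mu> \<epsilon> m \<beta>"
  define a where "a = OPT_at ?R 0"
  \<comment> \<open>If \<open>\<mu> = 1\<close>, the second interval is empty and \<open>b\<close>
    enters the integral with factor 0.\<close>
  define b where "b = OPT_at ?R 1"
  have interval: "active_interval (?R ! k) \<in> {{0..<1}, {0..<\<mu>}}" if "k < length ?R" for k
    using nth_mem[OF that] unfolding set_bad_instance[OF assms(5)] by (auto simp: bad_item_defs)
  have active_eq: "active_indices ?R t = active_indices ?R t'"
    if "t \<in> {0..<1} \<longleftrightarrow> t' \<in> {0..<1}" "t \<in> {0..<\<mu>} \<longleftrightarrow> t' \<in> {0..<\<mu>}" for t t'
    using interval that unfolding active_indices_def by blast
  have OPT_at_eq: "real (OPT_at ?R t) =
      real a * indicat_real {0..<1} t + real b * indicat_real {1..<\<mu>} t" for t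
  proof -
    consider "t \<in> {0..<1}" | "t \<in> {1..<\<mu>}" | "t \<notin> {0..<\<mu>}"
      using assms(4) by fastforce
    then show ?thesis
    proof cases
      case 1
      then have "OPT_at ?R t = a"
        unfolding a_def using assms(4) by (intro OPT_at_cong active_eq) auto
      with 1 show ?thesis by (simp add: indicator_def)
    next
      case 2
      then have "OPT_at ?R t = b"
        unfolding b_def by (intro OPT_at_cong active_eq) auto
      with 2 show ?thesis by (simp add: indicator_def)
    next
      case 3
      then have "active_indices ?R t = {}"
        using interval assms(4) by (fastforce simp: active_indices_def)
      with 3 assms(4) show ?thesis
        by (auto simp: OPT_at_eq_0 indicator_def)
    qed
  qed
  have OPT_eq: "OPT ?R = real a + real b * (\<mu> - 1)"
    unfolding OPT_def OPT_at_eq using assms(4) by (subst Bochner_Integration.integral_add) auto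
  note pack = packable_bad_instance[OF assms(1-3)]
  have "?R \<noteq> []"
    using assms(5) by (rule bad_instance_nonempty)
  then have "0 < length ?R"
    by simp
  then have "0 \<in> active_indices ?R 0"
    using interval[of 0] assms(4) unfolding active_indices_def by fastforce
  then have "a > 0"
    unfolding a_def using pack(1) by (rule OPT_at_pos)
  then show "0 < OPT ?R"
    unfolding OPT_eq using assms(4) by (simp add: add_pos_nonneg)
  have "a \<le> m + CARD('d) + 1"
    unfolding a_def OPT_at_def by (intro Least_le pack(1))
  then have "real a \<le> real m + real CARD('d) + 1"
    by (simp flip: of_nat_add of_nat_Suc)
  moreover have "b \<le> 1"
    unfolding b_def OPT_at_def by (intro Least_le pack(2)) simp
  then have "real b * (\<mu> - 1) \<le> 1 * (\<mu> - 1)"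
    using assms(4) by (intro mult_right_mono) auto
  ultimately have "OPT ?R \<le> real m + real CARD('d) + 1 + 1 * (\<mu> - 1)"
    unfolding OPT_eq by (rule add_mono)
  then show "OPT ?R \<le> real m + real CARD('d) + \<mu>"
    by simp
qed

subsection \<open>The lower bound\<close>

lemma valid_bad_instance:
  fixes \<beta> :: "nat \<Rightarrow> 'd::finite"
  assumes "0 < \<epsilon>" "\<epsilon> \<le> 1" "\<mu> > 0" "m > 0"
  shows "valid_instance (bad_instance \<mu> \<epsilon> m \<beta>)"
  using assms by (auto simp: valid_instance_def set_bad_instance valid_item_def bad_item_defs)

lemma duration_ratio_bad_instance:
  fixes \<beta> :: "nat \<Rightarrow> 'd::finite"
  assumes "\<mu> \<ge> 1" "m > 0"
  shows "duration_ratio (bad_instance \<mu> \<epsilon> m \<beta>) = \<mu>"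
proof -
  have "duration ` set (bad_instance \<mu> \<epsilon> m \<beta>) = {1, \<mu>}"
    by (auto simp: set_bad_instance[OF assms(2)] bad_item_defs image_Un image_image)
  then show ?thesis
    using assms by (simp add: duration_ratio_def)
qed

text \<open>Positivity of \<open>OPT R\<close> is included so that the cost bound can be divided by
  it to bound the competitive ratio.\<close>

lemma ex_bad_instance:
  fixes \<mu> \<delta> :: real
  assumes "\<mu> \<ge> 1" "\<delta> > 0"
  shows "\<exists>R :: 'd::finite item list. valid_instance R \<and> R \<noteq> [] \<and> duration_ratio R = \<mu> \<and>
    0 < OPT R \<and> cost next_fit R \<ge> (2 * \<mu> * real CARD('d) - \<delta>) * OPT R"
proof -
  define d where "d = real CARD('d)"
  have d: "d \<ge> 1"
    by (simp add: d_def Suc_le_eq)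
  obtain \<beta> :: "nat \<Rightarrow> 'd" where "bij_betw \<beta> {0..<CARD('d)} UNIV"
    using ex_bij_betw_nat_finite[of "UNIV :: 'd set"] by auto
  then have \<beta>: "inj_on \<beta> {..<CARD('d)}"
    by (simp add: bij_betw_def atLeast0LessThan)
  \<comment> \<open>Expanding \<open>(2 * \<mu> * d - \<delta>) * (m + d + \<mu>)\<close> shows that
    it is at most \<open>2 * \<mu> * d * m\<close> once \<open>\<delta> * m\<close> dominates
    \<open>2 * \<mu> * d * (d + \<mu>)\<close>. Passing to \<open>Suc m0\<close> makes
    \<open>m\<close> positive.\<close>
  obtain m0 :: nat where "2 * \<mu> * d * (d + \<mu>) / \<delta> \<le> real m0"
    using real_arch_simple by blast
  then have "2 * \<mu> * d * (d + \<mu>) / \<delta> \<le> real (Suc m0)"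
    by simp
  then obtain m where m: "m > 0" "2 * \<mu> * d * (d + \<mu>) \<le> \<delta> * real m"
    using assms(2) by (metis mult.commute pos_divide_le_eq zero_less_Suc)
  \<comment> \<open>With this size the \<open>2 * m * d\<close> tiny items together fill one bin
    exactly.\<close>
  define \<epsilon> where "\<epsilon> = 1 / (2 * real m * d)"
  have md: "1 \<le> real m * d"
    using m(1) d mult_mono[of 1 "real m" 1 d] by simp
  have \<epsilon>: "0 < \<epsilon>" "\<epsilon> \<le> 1/2" "2 * real m * d * \<epsilon> \<le> 1"
    using md by (auto simp: \<epsilon>_def field_simps)
  let ?R = "bad_instance \<mu> \<epsilon> m \<beta>"
  have OPT: "0 < OPT ?R" "OPT ?R \<le> real m + d + \<mu>"
    using OPT_bad_instance[OF \<epsilon>(1) _ \<beta> assms(1) m(1)] \<epsilon>(3) by (simp_all add: d_def)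
  have cost: "cost next_fit ?R = d * (2 * real m * \<mu> + 1)"
    using cost_bad_instance[OF \<epsilon>(1,2) assms(1)] by (simp add: d_def)
  have "(2 * \<mu> * d - \<delta>) * OPT ?R \<le> cost next_fit ?R"
  \<comment> \<open>The upper bound on \<open>OPT\<close> may be multiplied only by a nonnegative
    factor; for large \<open>\<delta>\<close> the left side is nonpositive anyway.\<close>
  proof (cases "2 * \<mu> * d - \<delta> \<ge> 0")
    case True
    then have "(2 * \<mu> * d - \<delta>) * OPT ?R \<le> (2 * \<mu> * d - \<delta>) * (real m + d + \<mu>)"
      using OPT(2) by (rule mult_left_mono[rotated])
    also have "\<dots> = 2 * \<mu> * d * real m + (2 * \<mu> * d * (d + \<mu>) - \<delta> * real m) - \<delta> * (d + \<mu>)"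
      by (simp add: algebra_simps)
    also have "\<dots> \<le> 2 * \<mu> * d * real m"
      using m(2) assms d mult_nonneg_nonneg[of \<delta> "d + \<mu>"] by linarith
    also have "\<dots> \<le> cost next_fit ?R"
      using d by (simp add: cost algebra_simps)
    finally show ?thesis .
  next
    case False
    then have "(2 * \<mu> * d - \<delta>) * OPT ?R \<le> 0"
      using OPT(1) by (simp add: mult_nonpos_nonneg)
    also have "0 \<le> cost next_fit ?R"
      using d assms(1) by (simp add: cost)
    finally show ?thesis .
  qed
  moreover have "?R \<noteq> []"
    using m(1) by (rule bad_instance_nonempty)
  moreover have "valid_instance ?R"
    using \<epsilon> assms(1) m(1) by (intro valid_bad_instance) auto
  ultimately show ?thesis
    using duration_ratio_bad_instance[OF assms(1) m(1)] OPT(1) unfolding d_def by blast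
qed

theorem theorem5:
  fixes \<mu> :: real
  assumes "\<mu> \<ge> 1"
  shows "competitive_ratio (next_fit :: ('d::finite) item list \<Rightarrow> 'd item list list) \<mu>
           \<ge> ereal (2 * \<mu> * real CARD('d)) \<and>
         (\<forall>\<delta>>0. \<exists>R :: 'd item list. valid_instance R \<and> R \<noteq> [] \<and> duration_ratio R = \<mu> \<and>
            cost next_fit R \<ge> (2 * \<mu> * real CARD('d) - \<delta>) * OPT R)"
proof
  show "competitive_ratio (next_fit :: 'd item list \<Rightarrow> 'd item list list) \<mu>
          \<ge> ereal (2 * \<mu> * real CARD('d))"
  \<comment> \<open>The supremum need not be attained, so the bound is shown up to each positive
    \<open>\<delta>\<close>.\<close>
  proof (rule ereal_le_epsilon2)
    fix \<delta> :: real assume "\<delta> > 0"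
    then obtain R :: "'d item list" where R: "valid_instance R" "R \<noteq> []" "duration_ratio R = \<mu>"
      "0 < OPT R" "cost next_fit R \<ge> (2 * \<mu> * real CARD('d) - \<delta>) * OPT R"
      using ex_bad_instance[OF assms] by metis
    then have "2 * \<mu> * real CARD('d) \<le> cost next_fit R / OPT R + \<delta>"
      by (simp add: field_simps)
    then have "ereal (2 * \<mu> * real CARD('d)) \<le> ereal (cost next_fit R / OPT R) + ereal \<delta>"
      by simp
    also have "ereal (cost next_fit R / OPT R) \<le>
        competitive_ratio (next_fit :: 'd item list \<Rightarrow> 'd item list list) \<mu>"
      unfolding competitive_ratio_def using R by (intro SUP_upper) auto
    finally show "ereal (2 * \<mu> * real CARD('d)) \<le>
        competitive_ratio (next_fit :: 'd item list \<Rightarrow> 'd item list list) \<mu> + ereal \<delta>"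
      by (simp add: add_right_mono)
  qed
  show "\<forall>\<delta>>0. \<exists>R :: 'd item list. valid_instance R \<and> R \<noteq> [] \<and> duration_ratio R = \<mu> \<and>
      cost next_fit R \<ge> (2 * \<mu> * real CARD('d) - \<delta>) * OPT R"
    using ex_bad_instance[OF assms] by blast
qed

end
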